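(* The vertex splitting move preserves infinitesimal rigidity for finite well-positioned bar-joint frameworks in $(\mathbb{R}^2,\|\cdot\|_{\mathcal{P}})$, for any polyhedral norm $\|\cdot\|_{\mathcal P}$ on $\mathbb{R}^2$. That is: if $(G,p)$ is a finite, well-positioned and infinitesimally rigid bar-joint framework in $(\mathbb{R}^2,\|\cdot\|_{\mathcal{P}})$ and $G'$ is obtained from $G$ by a vertex splitting move, then there exists a placement $p'$ of $G'$ such that $(G',p')$ is well-positioned and infinitesimally rigid in $(\mathbb{R}^2,\|\cdot\|_{\mathcal{P}})$.
   Context: Let $\mathcal{P}\subset\mathbb{R}^2$ be a convex symmetric ($\mathcal P=-\mathcal P$) $2$-dimensional polytope. The associated polyhedral norm is $\|x\|_{\mathcal{P}}=\inf\{\lambda\ge 0: x\in\lambda\mathcal{P}\}$. For a facet $F$ of $\mathcal P$, $\mathrm{cone}(F)$ is the set of all finite non-negative linear combinations of points of $F$. A placement of a simple graph $G=(V(G),E(G))$ is a map $p:V(G)\to\mathbb{R}^2$ with $p_v\neq p_w$ whenever $vw\in E(G)$; the pair $(G,p)$ is a bar-joint framework, finite if $G$ is finite. It is well-positioned if for each edge $vw$ the vector $p_v-p_w$ is contained in $\mathrm{cone}(F)$ for exactly one facet $F$ of $\mathcal{P}$. An infinitesimal flex of $(G,p)$ is a map $u:V(G)\to\mathbb{R}^2$ such that for each edge $vw$, $\|(p_v+tu_v)-(p_w+tu_w)\|_{\mathcal{P}}-\|p_v-p_w\|_{\mathcal{P}}=o(t)$ as $t\to 0$; it is trivial if it is constant.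 $(G,p)$ is infinitesimally rigid if every infinitesimal flex is trivial. A vertex splitting move $G\to G'$ adjoins a new vertex $v_0$ and two new edges $v_0v_1$ and $v_0v_2$ to $G$, where $v_1v_2$ is an edge of $G$; in addition, any of the edges $v_1w$ of $G$ incident with $v_1$ (other than $v_1v_2$, which is kept) may be replaced with the edge $v_0w$. *)

theory Defs
  imports "HOL-Analysis.Analysis" "HOL-Library.Landau_Symbols"
begin

definition simple_graph :: "'v set \<Rightarrow> 'v set set \<Rightarrow> bool" where
  "simple_graph V E \<longleftrightarrow> (\<forall>e\<in>E. e \<subseteq> V \<and> card e = 2)"

text \<open>The edges \<open>v\<^sub>1w\<close> that are moved to \<open>v\<^sub>0\<close> are those with \<open>w \<in> W\<close>; \<open>W\<close> may be any
  set (possibly empty) of neighbours of \<open>v\<^sub>1\<close> other than \<open>v\<^sub>2\<close>.\<close>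

definition vertex_splitting ::
    "'v set \<Rightarrow> 'v set set \<Rightarrow> 'v set \<Rightarrow> 'v set set \<Rightarrow> bool" where
  "vertex_splitting V E V' E' \<longleftrightarrow>
     (\<exists>v0 v1 v2 W. v0 \<notin> V \<and> {v1, v2} \<in> E \<and> W \<subseteq> {w. {v1, w} \<in> E} - {v2} \<and>
        V' = insert v0 V \<and>
        E' = (E - {{v1, w} |w. w \<in> W}) \<union> {{v0, w} |w. w \<in> W} \<union> {{v0, v1}, {v0, v2}})"

lemma vertex_splitting_simple_graph:
  assumes "simple_graph V E" and "vertex_splitting V E V' E'"
  shows "simple_graph V' E'"
proof -
  obtain v0 v1 v2 W where *: "v0 \<notin> V" "{v1, v2} \<in> E" "W \<subseteq> {w. {v1, w} \<in> E} - {v2}"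
    "V' = insert v0 V"
    "E' = (E - {{v1, w} |w. w \<in> W}) \<union> {{v0, w} |w. w \<in> W} \<union> {{v0, v1}, {v0, v2}}"
    using assms(2) unfolding vertex_splitting_def by blast
  have E: "e \<subseteq> V" "card e = 2" if "e \<in> E" for e
    using assms(1) that unfolding simple_graph_def by auto
  have V: "v1 \<in> V" "v2 \<in> V" "W \<subseteq> V" using E *(2,3) by blast+
  have new: "{v0, w} \<subseteq> V' \<and> card {v0, w} = 2" if "w \<in> V" for w
  proof -
    have "v0 \<noteq> w" using that *(1) by blast
    then show ?thesis using that *(4) by simp
  qed
  show ?thesis unfolding simple_graph_def
  proof
    fix e assume "e \<in> E'"
    then consider "e \<in> E" | w where "e = {v0, w}" "w \<in> V"
      using *(5) V by blast
    then show "e \<subseteq> V' \<and> card e = 2"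
    proof cases
      case 1
      then show ?thesis using E[of e] *(4) by auto
    next
      case 2
      then show ?thesis using new by simp
    qed
  qed
qed

definition norm_polytope :: "(real^2) set \<Rightarrow> bool" where
  "norm_polytope P \<longleftrightarrow> polytope P \<and> aff_dim P = 2 \<and> uminus ` P = P"

definition polyhedral_norm :: "(real^2) set \<Rightarrow> real^2 \<Rightarrow> real" where
  "polyhedral_norm P x = Inf {l. 0 \<le> l \<and> x \<in> (\<lambda>y. l *\<^sub>R y) ` P}"

definition nonneg_span :: "(real^2) set \<Rightarrow> (real^2) set" where
  "nonneg_span F = {(\<Sum>x\<in>T. c x *\<^sub>R x) |T c. finite T \<and> T \<subseteq> F \<and> (\<forall>x\<in>T. 0 \<le> c x)}"

text \<open>Placements, and likewise flexes, of a graph with vertex set \<open>V\<close> are total functions; their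
  values outside \<open>V\<close> play no role.\<close>

definition placement :: "'v set set \<Rightarrow> ('v \<Rightarrow> real^2) \<Rightarrow> bool" where
  "placement E p \<longleftrightarrow> (\<forall>v w. {v, w} \<in> E \<longrightarrow> p v \<noteq> p w)"

definition well_positioned :: "(real^2) set \<Rightarrow> 'v set set \<Rightarrow> ('v \<Rightarrow> real^2) \<Rightarrow> bool" where
  "well_positioned P E p \<longleftrightarrow>
     (\<forall>v w. {v, w} \<in> E \<longrightarrow> (\<exists>!F. F facet_of P \<and> p v - p w \<in> nonneg_span F))"

definition infinitesimal_flex ::
    "(real^2) set \<Rightarrow> 'v set set \<Rightarrow> ('v \<Rightarrow> real^2) \<Rightarrow> ('v \<Rightarrow> real^2) \<Rightarrow> bool" where
  "infinitesimal_flex P E p u \<longleftrightarrow>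
     (\<forall>v w. {v, w} \<in> E \<longrightarrow>
        (\<lambda>t::real. polyhedral_norm P ((p v + t *\<^sub>R u v) - (p w + t *\<^sub>R u w))
                   - polyhedral_norm P (p v - p w)) \<in> o[at 0](\<lambda>t. t))"

definition trivial_flex :: "'v set \<Rightarrow> ('v \<Rightarrow> real^2) \<Rightarrow> bool" where
  "trivial_flex V u \<longleftrightarrow> (\<exists>c. \<forall>v\<in>V. u v = c)"

definition infinitesimally_rigid ::
    "(real^2) set \<Rightarrow> 'v set \<Rightarrow> 'v set set \<Rightarrow> ('v \<Rightarrow> real^2) \<Rightarrow> bool" where
  "infinitesimally_rigid P V E p \<longleftrightarrow>
     (\<forall>u. infinitesimal_flex P E p u \<longrightarrow> trivial_flex V u)"

end

theory Submission
  imports Defs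
begin

text \<open>Normalise the normal \<open>n\<^sub>F\<close> of each facet \<open>F\<close> so that \<open>F = P \<inter> {x. n\<^sub>F \<bullet> x = 1}\<close>. The norm
  is the maximum of the functionals \<open>n\<^sub>F\<close>, a nonzero vector lies in the cone of exactly one facet
  iff this maximum is attained only once, and there an edge \<open>vw\<close> imposes on a flex \<open>u\<close> the linear
  condition \<open>n\<^sub>F \<bullet> (u\<^sub>v - u\<^sub>w) = 0\<close>. Place the new vertex at \<open>p\<^sub>v\<^sub>1 + s z\<close> with \<open>s\<close> small, so
  that the edges towards \<open>v\<^sub>2\<close> and the moved neighbours keep their facets, and with \<open>z\<close>
  in the open cone of a facet whose normal is independent of the one for \<open>v\<^sub>1v\<^sub>2\<close>. The edges of
  the triangle \<open>v\<^sub>0v\<^sub>1v\<^sub>2\<close> then force \<open>u\<^sub>v\<^sub>0 = u\<^sub>v\<^sub>1\<close>, and \<open>u\<close> restricts to a flex of the original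
  framework.\<close>

text \<open>The vertex of the polar polytope dual to \<open>F\<close>.\<close>

definition facet_normal :: "(real^2) set \<Rightarrow> (real^2) set \<Rightarrow> real^2" where
  "facet_normal P F = (SOME a. P \<subseteq> {x. a \<bullet> x \<le> 1} \<and> F = P \<inter> {x. a \<bullet> x = 1})"

text \<open>Describes the interior of the cone over \<open>F\<close> by finitely many strict linear
  inequalities, so that openness and scaling invariance are immediate.\<close>

definition strictly_maximal_facet :: "(real^2) set \<Rightarrow> real^2 \<Rightarrow> (real^2) set \<Rightarrow> bool" where
  "strictly_maximal_facet P x F \<longleftrightarrow> F facet_of P \<and> 0 < facet_normal P F \<bullet> x \<and>
     (\<forall>G. G facet_of P \<and> G \<noteq> F \<longrightarrow> facet_normal P G \<bullet> x < facet_normal P F \<bullet> x)"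

text \<open>Full dimension provides some interior point \<open>x\<close>; by symmetry
  \<open>- x\<close> is interior too, and by convexity so is their midpoint.\<close>

lemma norm_polytope_zero_interior:
  assumes "norm_polytope P"
  shows "0 \<in> interior P"
proof -
  have P: "polytope P" "aff_dim P = 2" "uminus ` P = P"
    using assms by (auto simp: norm_polytope_def)
  have conv: "convex P" using P(1) by (rule polytope_imp_convex)
  have "affine hull P = UNIV" using P(2) by (simp flip: aff_dim_eq_full)
  then have "interior P = rel_interior P" by (simp add: rel_interior_interior)
  moreover have "P \<noteq> {}" using P(2) by auto
  ultimately obtain x where x: "x \<in> interior P"
    using conv rel_interior_eq_empty by blast
  have "- x \<in> interior P" using x interior_negations[of P] P(3) by auto
  then have "(1/2) *\<^sub>R x + (1/2) *\<^sub>R (- x) \<in> interior P"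
    using x convex_interior[OF conv] by (intro convexD) auto
  then show ?thesis by simp
qed

section \<open>Facets and their normals\<close>

locale plane_polytope =
  fixes P :: "(real^2) set"
  assumes norm_polytope: "norm_polytope P"
begin

abbreviation normal where "normal \<equiv> facet_normal P"

lemma polytope: "polytope P"
  using norm_polytope by (simp add: norm_polytope_def)

lemma zero_interior: "0 \<in> interior P"
  by (rule norm_polytope_zero_interior[OF norm_polytope])

lemma finite_facets: "finite {F. F facet_of P}"
  using finite_polytope_facets[OF polytope] .

text \<open>A facet lies on a supporting line with right-hand side \<open>b\<close>. Since 0 is
  interior, \<open>b > 0\<close>, and division by \<open>b\<close> gives the normalisation.\<close>

lemma facet_normal:
  assumes "F facet_of P"
  shows "P \<subseteq> {x. normal F \<bullet> x \<le> 1}" and "F = P \<inter> {x. normal F \<bullet> x = 1}"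
proof -
  obtain a b where ab: "a \<noteq> 0" "P \<subseteq> {x. a \<bullet> x \<le> b}" "F = P \<inter> {x. a \<bullet> x = b}"
    using facet_of_polyhedron[OF polytope_imp_polyhedron[OF polytope] assms] by metis
  have "0 \<in> interior {x. a \<bullet> x \<le> b}"
    using zero_interior interior_mono[OF ab(2)] by blast
  then have b: "b > 0" using ab(1) by (simp add: interior_halfspace_le)
  have "P \<subseteq> {x. (a /\<^sub>R b) \<bullet> x \<le> 1} \<and> F = P \<inter> {x. (a /\<^sub>R b) \<bullet> x = 1}"
    using ab(2,3) b by (auto simp: field_simps)
  then have "P \<subseteq> {x. normal F \<bullet> x \<le> 1} \<and> F = P \<inter> {x. normal F \<bullet> x = 1}"
    unfolding facet_normal_def by (rule someI)
  then show "P \<subseteq> {x. normal F \<bullet> x \<le> 1}" and "F = P \<inter> {x. normal F \<bullet> x = 1}" by auto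
qed

lemma mem_facet_iff: "F facet_of P \<Longrightarrow> x \<in> F \<longleftrightarrow> x \<in> P \<and> normal F \<bullet> x = 1"
  using facet_normal(2) by blast

lemma normal_le_1: "F facet_of P \<Longrightarrow> x \<in> P \<Longrightarrow> normal F \<bullet> x \<le> 1"
  using facet_normal(1) by blast

text \<open>The ray from the interior point 0 meets the frontier, which for a full-dimensional
  polytope is the union of the facets.\<close>

lemma facet_through_ray:
  assumes "x \<noteq> 0"
  obtains d F where "d > 0" "F facet_of P" "d *\<^sub>R x \<in> F"
proof -
  obtain d where d: "0 < d" "0 + d *\<^sub>R x \<in> frontier P"
    using ray_to_frontier[OF polytope_imp_bounded[OF polytope] zero_interior assms] by metis
  have "rel_interior P = interior P"
    using zero_interior by (metis empty_iff interior_rel_interior_gen rel_interior_nonempty_interior)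
  then have "P - interior P = \<Union>{F. F facet_of P}"
    using rel_boundary_of_polyhedron[OF polytope_imp_polyhedron[OF polytope]] by simp
  moreover have "frontier P = P - interior P"
    using polytope_imp_closed[OF polytope] by (simp add: frontier_def)
  ultimately show thesis using d that by auto
qed

section \<open>The norm as the maximum of the normals\<close>

lemma polyhedral_norm_attained:
  assumes "d > 0" "F facet_of P" "d *\<^sub>R x \<in> F"
  shows "polyhedral_norm P x = 1 / d" and "polyhedral_norm P x = normal F \<bullet> x"
proof -
  have dx: "d *\<^sub>R x \<in> P" "normal F \<bullet> (d *\<^sub>R x) = 1"
    using assms(3) mem_facet_iff[OF assms(2)] by blast+
  have eq: "normal F \<bullet> x = 1 / d" using dx(2) assms(1) by (simp add: field_simps)
  have "x = (1 / d) *\<^sub>R (d *\<^sub>R x)" using assms(1) by simp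
  then have mem: "1 / d \<in> {l. 0 \<le> l \<and> x \<in> (\<lambda>y. l *\<^sub>R y) ` P}"
    using assms(1) dx(1) by force
  \<comment> \<open>The normal is at most 1 on \<open>P\<close>, so \<open>x = l *\<^sub>R y\<close>
    with \<open>y\<close> in \<open>P\<close> bounds its value at \<open>x\<close>, which is
    \<open>1 / d\<close>, by \<open>l\<close>.\<close>
  have lower: "1 / d \<le> l" if l: "l \<in> {l. 0 \<le> l \<and> x \<in> (\<lambda>y. l *\<^sub>R y) ` P}" for l
  proof -
    obtain y where y: "0 \<le> l" "y \<in> P" "x = l *\<^sub>R y" using l by blast
    have "normal F \<bullet> y \<le> 1" using normal_le_1[OF assms(2) y(2)] .
    then have "normal F \<bullet> x \<le> l" using y(1,3) by (simp add: mult_left_le)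
    then show ?thesis using eq by simp
  qed
  show "polyhedral_norm P x = 1 / d"
    unfolding polyhedral_norm_def by (rule cInf_eq_minimum[OF mem lower])
  then show "polyhedral_norm P x = normal F \<bullet> x" using eq by simp
qed

lemma polyhedral_norm_pos:
  assumes "x \<noteq> 0"
  shows "0 < polyhedral_norm P x"
  using facet_through_ray[OF assms] polyhedral_norm_attained(1)
  by (metis zero_less_divide_1_iff)

lemma normal_le_polyhedral_norm:
  assumes "x \<noteq> 0" "G facet_of P"
  shows "normal G \<bullet> x \<le> polyhedral_norm P x"
proof -
  obtain d F where dF: "d > 0" "F facet_of P" "d *\<^sub>R x \<in> F"
    using facet_through_ray[OF assms(1)] .
  have "d *\<^sub>R x \<in> P" using dF(2,3) mem_facet_iff by blast
  then have "normal G \<bullet> (d *\<^sub>R x) \<le> 1" using normal_le_1[OF assms(2)] by blast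
  then show ?thesis using dF(1) unfolding polyhedral_norm_attained(1)[OF dF] by (simp add: field_simps)
qed

lemma polyhedral_norm_eq_normal:
  assumes "x \<noteq> 0"
  obtains F where "F facet_of P" "polyhedral_norm P x = normal F \<bullet> x"
  using facet_through_ray[OF assms] polyhedral_norm_attained(2) by metis

text \<open>On a nonnegative combination of points of \<open>F\<close>, \<open>normal F\<close>
  gives the sum of the coefficients and every other normal at most that sum. Conversely, if
  \<open>normal F\<close> attains the norm, then the boundary point on the ray through
  \<open>x\<close> lies in \<open>F\<close>.\<close>

lemma mem_nonneg_span_facet_iff:
  assumes "x \<noteq> 0" "F facet_of P"
  shows "x \<in> nonneg_span F \<longleftrightarrow> normal F \<bullet> x = polyhedral_norm P x"
proof
  assume "x \<in> nonneg_span F"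
  then obtain T c where T: "x = (\<Sum>y\<in>T. c y *\<^sub>R y)" "finite T" "T \<subseteq> F" "\<forall>y\<in>T. 0 \<le> c y"
    unfolding nonneg_span_def by blast
  have F: "normal F \<bullet> x = sum c T"
    unfolding T(1) inner_sum_right using T(3) mem_facet_iff[OF assms(2)]
    by (intro sum.cong) auto
  obtain G where G: "G facet_of P" "polyhedral_norm P x = normal G \<bullet> x"
    using polyhedral_norm_eq_normal[OF assms(1)] .
  have "normal G \<bullet> x \<le> sum c T"
    unfolding T(1) inner_sum_right
  proof (rule sum_mono)
    fix y assume y: "y \<in> T"
    then have "y \<in> P" using T(3) mem_facet_iff[OF assms(2)] by blast
    then have "normal G \<bullet> y \<le> 1" using normal_le_1[OF G(1)] by blast
    then show "normal G \<bullet> (c y *\<^sub>R y) \<le> c y" using T(4) y by (simp add: mult_left_le)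
  qed
  then show "normal F \<bullet> x = polyhedral_norm P x"
    using F G(2) normal_le_polyhedral_norm[OF assms] by simp
next
  assume eq: "normal F \<bullet> x = polyhedral_norm P x"
  obtain d G where dG: "d > 0" "G facet_of P" "d *\<^sub>R x \<in> G"
    using facet_through_ray[OF assms(1)] .
  have "d *\<^sub>R x \<in> P" using dG(2,3) mem_facet_iff by blast
  moreover have "normal F \<bullet> (d *\<^sub>R x) = 1"
    using eq polyhedral_norm_attained(1)[OF dG] dG(1) by simp
  ultimately have "d *\<^sub>R x \<in> F" using mem_facet_iff[OF assms(2)] by blast
  moreover have "x = (\<Sum>y\<in>{d *\<^sub>R x}. (1 / d) *\<^sub>R y)" using dG(1) by simp
  ultimately show "x \<in> nonneg_span F"
    unfolding nonneg_span_def using dG(1)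
    by (intro CollectI exI[of _ "{d *\<^sub>R x}"] exI[of _ "\<lambda>_. 1 / d"]) auto
qed

section \<open>Open cones of facets and differentiability of the norm\<close>

lemma strictly_maximal_facet_nonzero: "strictly_maximal_facet P x F \<Longrightarrow> x \<noteq> 0"
  by (auto simp: strictly_maximal_facet_def)

lemma polyhedral_norm_strictly_maximal:
  assumes "strictly_maximal_facet P x F"
  shows "polyhedral_norm P x = normal F \<bullet> x"
proof -
  have x: "x \<noteq> 0" using assms by (rule strictly_maximal_facet_nonzero)
  obtain G where "G facet_of P" "polyhedral_norm P x = normal G \<bullet> x"
    using polyhedral_norm_eq_normal[OF x] .
  then show ?thesis
    using assms normal_le_polyhedral_norm[OF x, of F]
    unfolding strictly_maximal_facet_def by fastforce
qed

text \<open>The cones containing \<open>x\<close> belong to the normals that attain the norm, so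
  uniqueness of the cone means that the maximum has no ties.\<close>

lemma ex1_nonneg_span_facet_iff:
  assumes "x \<noteq> 0"
  shows "(\<exists>!F. F facet_of P \<and> x \<in> nonneg_span F) \<longleftrightarrow> (\<exists>F. strictly_maximal_facet P x F)"
proof
  assume "\<exists>!F. F facet_of P \<and> x \<in> nonneg_span F"
  then obtain F where F: "F facet_of P" "x \<in> nonneg_span F"
    and uniq: "\<And>G. G facet_of P \<Longrightarrow> x \<in> nonneg_span G \<Longrightarrow> G = F" by blast
  have eq: "normal F \<bullet> x = polyhedral_norm P x"
    using F mem_nonneg_span_facet_iff[OF assms] by blast
  have "normal G \<bullet> x < normal F \<bullet> x" if "G facet_of P" "G \<noteq> F" for G
    using that uniq[of G] normal_le_polyhedral_norm[OF assms that(1)] eq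
      mem_nonneg_span_facet_iff[OF assms that(1)] by fastforce
  then show "\<exists>F. strictly_maximal_facet P x F"
    using F(1) eq polyhedral_norm_pos[OF assms] unfolding strictly_maximal_facet_def by metis
next
  assume "\<exists>F. strictly_maximal_facet P x F"
  then obtain F where F: "strictly_maximal_facet P x F" by blast
  have "F facet_of P \<and> x \<in> nonneg_span F"
    using F polyhedral_norm_strictly_maximal[OF F] mem_nonneg_span_facet_iff[OF assms]
    by (auto simp: strictly_maximal_facet_def)
  moreover have "G = F" if "G facet_of P \<and> x \<in> nonneg_span G" for G
    using that F polyhedral_norm_strictly_maximal[OF F] mem_nonneg_span_facet_iff[OF assms]
    unfolding strictly_maximal_facet_def by fastforce
  ultimately show "\<exists>!F. F facet_of P \<and> x \<in> nonneg_span F" by blast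
qed

lemma open_strictly_maximal_facet: "open {x. strictly_maximal_facet P x F}"
proof (cases "F facet_of P")
  case True
  have "{x. strictly_maximal_facet P x F} = {x. 0 < normal F \<bullet> x} \<inter>
      (\<Inter>G\<in>{G. G facet_of P} - {F}. {x. normal G \<bullet> x < normal F \<bullet> x})"
    using True by (auto simp: strictly_maximal_facet_def)
  also have "open \<dots>"
    using finite_facets
    by (intro open_Int open_INT ballI open_Collect_less continuous_intros) auto
  finally show ?thesis .
qed (simp add: strictly_maximal_facet_def)

lemma eventually_strictly_maximal_facet:
  assumes "strictly_maximal_facet P x F"
  shows "\<forall>\<^sub>F t in at 0. strictly_maximal_facet P (x + t *\<^sub>R z) F"
proof -
  have "((\<lambda>t. x + t *\<^sub>R z) \<longlongrightarrow> x + 0 *\<^sub>R z) (at 0)" by (intro tendsto_intros)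
  then show ?thesis
    using topological_tendstoD[OF _ open_strictly_maximal_facet[of F]] assms by force
qed

lemma eventually_at_right_strictly_maximal_facet:
  assumes "strictly_maximal_facet P x F"
  shows "\<forall>\<^sub>F t in at_right 0. strictly_maximal_facet P (x + t *\<^sub>R z) F"
  using eventually_strictly_maximal_facet[OF assms] by (simp add: eventually_at_split)

lemma strictly_maximal_facet_scaleR:
  assumes "strictly_maximal_facet P x F" "s > 0"
  shows "strictly_maximal_facet P (s *\<^sub>R x) F"
  using assms by (auto simp: strictly_maximal_facet_def)

text \<open>Near \<open>x\<close> the norm coincides with the linear functional
  \<open>normal F\<close>, so the difference is an exact multiple of \<open>t\<close> for small
  \<open>t\<close>.\<close>

lemma polyhedral_norm_derivative_zero_iff:
  assumes "strictly_maximal_facet P x F"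
  shows "(\<lambda>t. polyhedral_norm P (x + t *\<^sub>R d) - polyhedral_norm P x) \<in> o[at 0](\<lambda>t. t)
    \<longleftrightarrow> normal F \<bullet> d = 0"
proof -
  have "\<forall>\<^sub>F t in at 0. polyhedral_norm P (x + t *\<^sub>R d) - polyhedral_norm P x = (normal F \<bullet> d) * t"
    using eventually_strictly_maximal_facet[OF assms, of d]
    by eventually_elim
      (simp add: polyhedral_norm_strictly_maximal polyhedral_norm_strictly_maximal[OF assms]
        inner_add_right)
  then have "(\<lambda>t. polyhedral_norm P (x + t *\<^sub>R d) - polyhedral_norm P x) \<in> o[at 0](\<lambda>t. t)
    \<longleftrightarrow> (\<lambda>t. (normal F \<bullet> d) * t) \<in> o[at 0](\<lambda>t::real. t)"
    by (rule landau_o.small.in_cong)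
  also have "\<dots> \<longleftrightarrow> normal F \<bullet> d = 0"
  proof (cases "normal F \<bullet> d = 0")
    case False
    \<comment> \<open>The identity is \<open>o(t)\<close> only if it vanishes eventually, which the
      punctured filter at 0 excludes.\<close>
    have "\<exists>\<^sub>F t in at 0. (t::real) \<noteq> 0"
      by (intro eventually_frequently) (auto simp: eventually_at_filter)
    then show ?thesis using False by (simp add: landau_o.small_refl_iff frequently_def)
  qed simp
  finally show ?thesis .
qed

section \<open>Directions in general position\<close>

lemma exists_generic_direction:
  assumes "open U" "U \<noteq> {}"
  obtains z where "z \<in> U" "\<And>G H. \<lbrakk>G facet_of P; H facet_of P; G \<noteq> H\<rbrakk> \<Longrightarrow> normal G \<bullet> z \<noteq> normal H \<bullet> z"
    "z \<noteq> 0"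
proof -
  \<comment> \<open>A finite union of lines, on each of which two normals tie; being a null set, it
    cannot cover a nonempty open set.\<close>
  define B where "B = (\<Union>(G,H)\<in>({G. G facet_of P} \<times> {H. H facet_of P}) - Id.
    {z. (normal G - normal H) \<bullet> z = 0})"
  have "negligible B"
    unfolding B_def
  proof (rule negligible_Union)
    show "finite ((\<lambda>(G,H). {z. (normal G - normal H) \<bullet> z = 0}) `
        (({G. G facet_of P} \<times> {H. H facet_of P}) - Id))"
      using finite_facets by auto
    fix S assume "S \<in> (\<lambda>(G,H). {z. (normal G - normal H) \<bullet> z = 0}) `
        (({G. G facet_of P} \<times> {H. H facet_of P}) - Id)"
    then obtain G H where GH: "G facet_of P" "H facet_of P" "G \<noteq> H"
      and S: "S = {z. (normal G - normal H) \<bullet> z = 0}" by auto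
    \<comment> \<open>A facet is recovered from its normal, so each tie set is a genuine
      line.\<close>
    have "normal G \<noteq> normal H" using facet_normal(2) GH by metis
    then show "negligible S" unfolding S by (intro negligible_hyperplane) auto
  qed
  then have "negligible (insert 0 B)" by simp
  then have "\<not> U \<subseteq> insert 0 B"
    using open_not_negligible[OF assms] negligible_subset by blast
  then obtain z where "z \<in> U" "z \<notin> B" "z \<noteq> 0" by auto
  then show thesis using that by (auto simp: B_def inner_diff_left)
qed

lemma generic_strictly_maximal_facet:
  assumes "z \<noteq> 0"
    and "\<And>G H. \<lbrakk>G facet_of P; H facet_of P; G \<noteq> H\<rbrakk> \<Longrightarrow> normal G \<bullet> z \<noteq> normal H \<bullet> z"
  obtains F where "strictly_maximal_facet P z F"
proof -
  obtain F where F: "F facet_of P" "polyhedral_norm P z = normal F \<bullet> z"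
    using polyhedral_norm_eq_normal[OF assms(1)] .
  then have "strictly_maximal_facet P z F"
    using polyhedral_norm_pos[OF assms(1)] normal_le_polyhedral_norm[OF assms(1)] assms(2)
    by (fastforce simp: strictly_maximal_facet_def)
  then show thesis by (rule that)
qed

text \<open>In the plane, \<open>d\<close> and \<open>e\<close> are parallel because both are
  orthogonal to \<open>a\<close>; as \<open>b\<close> annihilates \<open>d\<close> but not
  \<open>e\<close>, only \<open>d = 0\<close> remains.\<close>

lemma orthogonal_plane_eq_zero:
  fixes a b d e :: "real^2"
  assumes "a \<noteq> 0" "a \<bullet> e = 0" "a \<bullet> d = 0" "b \<bullet> e \<noteq> 0" "b \<bullet> d = 0"
  shows "d = 0"
proof -
  have c: "a $ 1 * e $ 1 + a $ 2 * e $ 2 = 0" "a $ 1 * d $ 1 + a $ 2 * d $ 2 = 0"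
      "b $ 1 * d $ 1 + b $ 2 * d $ 2 = 0" "a $ 1 \<noteq> 0 \<or> a $ 2 \<noteq> 0"
    using assms by (auto simp: inner_vec_def sum_2 vec_eq_iff forall_2)
  \<comment> \<open>The bracket is the determinant of \<open>e\<close> and \<open>d\<close>.\<close>
  have "a $ 1 * (e $ 1 * d $ 2 - e $ 2 * d $ 1) = 0" "a $ 2 * (e $ 1 * d $ 2 - e $ 2 * d $ 1) = 0"
    using c(1,2) by algebra+
  then have det: "e $ 1 * d $ 2 = e $ 2 * d $ 1" using c(4) by auto
  have "d $ 1 * (b $ 1 * e $ 1 + b $ 2 * e $ 2) = 0" "d $ 2 * (b $ 1 * e $ 1 + b $ 2 * e $ 2) = 0"
    using c(3) det by algebra+
  moreover have "b $ 1 * e $ 1 + b $ 2 * e $ 2 \<noteq> 0"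
    using assms(4) by (simp add: inner_vec_def sum_2)
  ultimately show ?thesis by (simp add: vec_eq_iff forall_2)
qed

text \<open>The direction \<open>z\<close> is a generic point near a vector \<open>e\<close> orthogonal to \<open>a\<close>: the normals
  parallel to \<open>a\<close> vanish at \<open>e\<close>, so their facets are not maximal near \<open>e\<close>.\<close>

lemma exists_transversal_direction:
  fixes a :: "real^2"
  assumes "a \<noteq> 0"
  obtains z F F' where "strictly_maximal_facet P z F" "strictly_maximal_facet P (- z) F'"
    "\<And>d. a \<bullet> d = 0 \<Longrightarrow> normal F \<bullet> d = 0 \<Longrightarrow> d = 0"
proof -
  \<comment> \<open>The vector \<open>a\<close> turned by a right angle.\<close>
  define e :: "real^2" where "e = vector [- (a $ 2), a $ 1]"
  have e: "e \<noteq> 0" "a \<bullet> e = 0"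
    using assms by (auto simp: e_def vec_eq_iff forall_2 inner_vec_def sum_2)
  obtain G where G: "G facet_of P" "polyhedral_norm P e = normal G \<bullet> e"
    using polyhedral_norm_eq_normal[OF e(1)] .
  have Ge: "0 < normal G \<bullet> e" using polyhedral_norm_pos[OF e(1)] G(2) by simp
  define U where "U = (\<Inter>H\<in>{H. H facet_of P \<and> normal H \<bullet> e = 0}.
    {z. normal H \<bullet> z < normal G \<bullet> z})"
  have "open U" unfolding U_def using finite_facets
    by (intro open_INT ballI open_Collect_less continuous_intros) auto
  moreover have "e \<in> U" using Ge by (simp add: U_def)
  ultimately obtain z where z: "z \<in> U" "z \<noteq> 0"
    "\<And>G H. \<lbrakk>G facet_of P; H facet_of P; G \<noteq> H\<rbrakk> \<Longrightarrow> normal G \<bullet> z \<noteq> normal H \<bullet> z"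
    using exists_generic_direction by (metis empty_iff)
  obtain F where F: "strictly_maximal_facet P z F"
    using generic_strictly_maximal_facet[OF z(2,3)] .
  \<comment> \<open>Absence of ties is symmetric under negation. The facet of \<open>- z\<close>
    serves the edge between the new vertex and \<open>v1\<close> when read from
    \<open>v1\<close>.\<close>
  obtain F' where F': "strictly_maximal_facet P (- z) F'"
    using generic_strictly_maximal_facet[of "- z"] z(2,3) by auto
  have "normal F \<bullet> e \<noteq> 0"
  proof
    assume "normal F \<bullet> e = 0"
    then have "normal F \<bullet> z < normal G \<bullet> z"
      using z(1) F by (auto simp: U_def strictly_maximal_facet_def)
    then show False
      using F G(1) by (metis less_asym strictly_maximal_facet_def)
  qed
  then show thesis
    using that[OF F F'] orthogonal_plane_eq_zero[OF assms e(2)] by blast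
qed

section \<open>Frameworks in terms of normals\<close>

lemma infinitesimal_flex_edge_iff:
  assumes "strictly_maximal_facet P (p v - p w) F"
  shows "(\<lambda>t. polyhedral_norm P ((p v + t *\<^sub>R u v) - (p w + t *\<^sub>R u w))
      - polyhedral_norm P (p v - p w)) \<in> o[at 0](\<lambda>t. t) \<longleftrightarrow> normal F \<bullet> (u v - u w) = 0"
proof -
  have "(p v + t *\<^sub>R u v) - (p w + t *\<^sub>R u w) = (p v - p w) + t *\<^sub>R (u v - u w)" for t
    by (simp add: algebra_simps)
  then show ?thesis using polyhedral_norm_derivative_zero_iff[OF assms] by (simp only:)
qed

text \<open>Reversing an edge negates its difference vector and so changes the facet; hence
  \<open>F\<close> depends on the ordered pair.\<close>

lemma infinitesimal_flex_iff:
  assumes "\<And>v w. {v, w} \<in> E \<Longrightarrow> strictly_maximal_facet P (p v - p w) (F v w)"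
  shows "infinitesimal_flex P E p u \<longleftrightarrow>
    (\<forall>v w. {v, w} \<in> E \<longrightarrow> normal (F v w) \<bullet> (u v - u w) = 0)"
  unfolding infinitesimal_flex_def
  using assms by (intro all_cong1 imp_cong infinitesimal_flex_edge_iff refl)

text \<open>The two notions are treated together because the cone criterion concerns nonzero
  vectors; choice then collects the facets into one function.\<close>

lemma well_positioned_placement_iff:
  "placement E p \<and> well_positioned P E p \<longleftrightarrow>
    (\<exists>F. \<forall>v w. {v, w} \<in> E \<longrightarrow> strictly_maximal_facet P (p v - p w) (F v w))"
proof -
  have edge: "(p v \<noteq> p w \<and> (\<exists>!F. F facet_of P \<and> p v - p w \<in> nonneg_span F)) \<longleftrightarrow>
      (\<exists>F. strictly_maximal_facet P (p v - p w) F)" for v w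
    using ex1_nonneg_span_facet_iff[of "p v - p w"] strictly_maximal_facet_nonzero[of "p v - p w"]
    by (cases "p v = p w") auto
  have "placement E p \<and> well_positioned P E p \<longleftrightarrow>
      (\<forall>v w. {v, w} \<in> E \<longrightarrow> (\<exists>F. strictly_maximal_facet P (p v - p w) F))"
    unfolding placement_def well_positioned_def edge[symmetric]
    by (simp only: imp_conjR all_conj_distrib)
  also have "\<dots> \<longleftrightarrow>
      (\<exists>F. \<forall>v w. {v, w} \<in> E \<longrightarrow> strictly_maximal_facet P (p v - p w) (F v w))"
    by metis
  finally show ?thesis .
qed

end

theorem proposition4p7:
  fixes P :: "(real^2) set"
    and V V' :: "'v set" and E E' :: "'v set set"
    and p :: "'v \<Rightarrow> real^2"
  assumes "norm_polytope P"
    and "simple_graph V E" and "finite V"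
    and "placement E p" and "well_positioned P E p"
    and "infinitesimally_rigid P V E p"
    and "vertex_splitting V E V' E'"
  shows "\<exists>p'. placement E' p' \<and> well_positioned P E' p' \<and> infinitesimally_rigid P V' E' p'"
proof -
  interpret plane_polytope P using assms(1) by unfold_locales
  obtain F where F: "\<And>v w. {v, w} \<in> E \<Longrightarrow> strictly_maximal_facet P (p v - p w) (F v w)"
    using assms(4,5) well_positioned_placement_iff[of E p] by blast
  obtain v0 v1 v2 W where v0: "v0 \<notin> V" and v12: "{v1, v2} \<in> E"
    and W: "W \<subseteq> {w. {v1, w} \<in> E} - {v2}" and V': "V' = insert v0 V"
    and E': "E' = (E - {{v1, w} |w. w \<in> W}) \<union> {{v0, w} |w. w \<in> W} \<union> {{v0, v1}, {v0, v2}}"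
    using assms(7) unfolding vertex_splitting_def by blast
  have in_V: "v \<in> V" "w \<in> V" "v \<noteq> w" if "{v, w} \<in> E" for v w
    using that assms(2) unfolding simple_graph_def by fastforce+
  \<comment> \<open>The vertices other than \<open>v1\<close> that become adjacent to
    \<open>v0\<close>; each is already a neighbour of \<open>v1\<close>.\<close>
  define N where "N = insert v2 W"
  have N: "{v1, w} \<in> E" "{w, v1} \<in> E" "w \<in> V" "w \<noteq> v0" if "w \<in> N" for w
    using that v12 W v0 in_V[of v1 w] by (auto simp: N_def insert_commute)
  have finN: "finite N" using N(3) assms(3) by (meson finite_subset subsetI)
  have a: "normal (F v1 v2) \<noteq> 0"
    using F[OF v12] by (auto simp: strictly_maximal_facet_def)
  obtain z H H' where z: "strictly_maximal_facet P z H" "strictly_maximal_facet P (- z) H'"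
    and transversal: "\<And>d. normal (F v1 v2) \<bullet> d = 0 \<Longrightarrow> normal H \<bullet> d = 0 \<Longrightarrow> d = 0"
    using exists_transversal_direction[OF a] by metis
  \<comment> \<open>Finitely many open conditions hold at \<open>s = 0\<close>, one for each
    orientation of each edge from \<open>v1\<close> to \<open>N\<close>, so they persist for small
    positive \<open>s\<close>.\<close>
  have "\<forall>\<^sub>F s in at_right 0. s > 0 \<and>
      (\<forall>w\<in>N. strictly_maximal_facet P (p v1 - p w + s *\<^sub>R z) (F v1 w)) \<and>
      (\<forall>w\<in>N. strictly_maximal_facet P (p w - p v1 + s *\<^sub>R (- z)) (F w v1))"
    using finN N(1,2)
    by (intro eventually_conj eventually_ball_finite ballI eventually_at_right_less
        eventually_at_right_strictly_maximal_facet F) auto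
  then obtain s where s: "s > 0"
    "\<And>w. w \<in> N \<Longrightarrow> strictly_maximal_facet P (p v1 - p w + s *\<^sub>R z) (F v1 w)"
    "\<And>w. w \<in> N \<Longrightarrow> strictly_maximal_facet P (p w - p v1 + s *\<^sub>R (- z)) (F w v1)"
    using eventually_happens'[OF trivial_limit_at_right_real] by blast
  define p' where "p' = p(v0 := p v1 + s *\<^sub>R z)"
  \<comment> \<open>An edge from \<open>v0\<close> to \<open>N\<close> inherits the facet of the
    corresponding edge at \<open>v1\<close>; only the edge \<open>v0v1\<close> receives new facets,
    \<open>H\<close> and \<open>H'\<close>.\<close>
  define F' where "F' v w =
    (if {v, w} \<in> E then F v w
     else if v = v0 then (if w = v1 then H else F v1 w)
     else (if v = v1 then H' else F v v1))" for v w
  have v1: "v1 \<in> V" "v1 \<noteq> v0" "v1 \<notin> N" using in_V[OF v12] in_V(3) N(1) v0 by auto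
  have not_E: "{v0, w} \<notin> E" "{w, v0} \<notin> E" for w using in_V v0 by blast+
  have cases_E': thesis if e: "{v, w} \<in> E'"
    and "{v, w} \<in> E \<Longrightarrow> thesis" "\<lbrakk>v = v0; w \<in> N\<rbrakk> \<Longrightarrow> thesis" "\<lbrakk>w = v0; v \<in> N\<rbrakk> \<Longrightarrow> thesis"
      "\<lbrakk>v = v0; w = v1\<rbrakk> \<Longrightarrow> thesis" "\<lbrakk>v = v1; w = v0\<rbrakk> \<Longrightarrow> thesis" for v w thesis
    using that unfolding E' N_def by (auto simp: doubleton_eq_iff)
  have F': "strictly_maximal_facet P (p' v - p' w) (F' v w)" if "{v, w} \<in> E'" for v w
    using that
  proof (rule cases_E')
    assume "{v, w} \<in> E"
    then show ?thesis using F[of v w] in_V[of v w] v0 by (auto simp: p'_def F'_def)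
  next
    assume "v = v0" "w \<in> N"
    then show ?thesis using s(2)[of w] N(4) v1 not_E by (auto simp: p'_def F'_def algebra_simps)
  next
    assume "w = v0" "v \<in> N"
    then show ?thesis using s(3)[of v] N(4) v1 not_E by (auto simp: p'_def F'_def algebra_simps)
  next
    assume "v = v0" "w = v1"
    then show ?thesis using strictly_maximal_facet_scaleR[OF z(1) s(1)] v1 not_E
      by (auto simp: p'_def F'_def)
  next
    assume "v = v1" "w = v0"
    then show ?thesis using strictly_maximal_facet_scaleR[OF z(2) s(1)] v1 not_E
      by (auto simp: p'_def F'_def)
  qed
  have "infinitesimally_rigid P V' E' p'"
    unfolding infinitesimally_rigid_def
  proof (intro allI impI)
    fix u assume "infinitesimal_flex P E' p' u"
    then have flex: "\<And>v w. {v, w} \<in> E' \<Longrightarrow> normal (F' v w) \<bullet> (u v - u w) = 0"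
      using infinitesimal_flex_iff[of E' p' F'] F' by blast
    have new: "{v0, v1} \<in> E'" "\<And>w. w \<in> N \<Longrightarrow> {v0, w} \<in> E' \<and> {w, v0} \<in> E'"
      by (auto simp: E' N_def insert_commute)
    have v2: "v2 \<in> N" "{v1, v2} \<in> E'"
      using v12 W in_V(3) by (auto simp: E' N_def doubleton_eq_iff)
    \<comment> \<open>The edges \<open>v1v2\<close> and \<open>v0v2\<close> carry the same normal,
      so subtracting their conditions eliminates \<open>u v2\<close>.\<close>
    have "normal (F v1 v2) \<bullet> (u v1 - u v2) = 0"
      using flex[OF v2(2)] v12 by (simp add: F'_def)
    moreover have "normal (F v1 v2) \<bullet> (u v0 - u v2) = 0"
      using flex[of v0 v2] new(2)[OF v2(1)] not_E v1 v2(1) by (auto simp: F'_def split: if_splits)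
    ultimately have "normal (F v1 v2) \<bullet> (u v0 - u v1) = 0"
      by (simp add: inner_diff_right)
    moreover have "normal H \<bullet> (u v0 - u v1) = 0"
      using flex[OF new(1)] not_E by (simp add: F'_def)
    ultimately have u01: "u v0 = u v1" using transversal by fastforce
    have "normal (F v w) \<bullet> (u v - u w) = 0" if e: "{v, w} \<in> E" for v w
    proof (cases "{v, w} \<in> E'")
      case True
      then show ?thesis using flex[OF True] e by (simp add: F'_def)
    next
      \<comment> \<open>A removed edge joins \<open>v1\<close> to some \<open>w\<close> in
        \<open>W\<close>. Its replacement at \<open>v0\<close> has the same normal, and
        \<open>u v0 = u v1\<close> carries the condition back.\<close>
      case False
      then consider "v = v1" "w \<in> N" | "w = v1" "v \<in> N"
        using e by (auto simp: E' N_def doubleton_eq_iff)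
      then show ?thesis
      proof cases
        case 1
        then show ?thesis using flex[of v0 w] new(2) not_E v1 u01 by (auto simp: F'_def split: if_splits)
      next
        case 2
        then show ?thesis using flex[of v v0] new(2) not_E v1 N(4) u01 by (auto simp: F'_def split: if_splits)
      qed
    qed
    then have "infinitesimal_flex P E p u"
      using infinitesimal_flex_iff[of E p F] F by blast
    then obtain c where "\<forall>v\<in>V. u v = c"
      using assms(6) by (auto simp: infinitesimally_rigid_def trivial_flex_def)
    then show "trivial_flex V' u"
      using u01 v1(1) by (auto simp: trivial_flex_def V')
  qed
  moreover have "placement E' p' \<and> well_positioned P E' p'"
    using F' well_positioned_placement_iff[of E' p'] by blast
  ultimately show ?thesis by blast
qed

end
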